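(* Let $n\geq2$ and let $G$ be a finite simple graph of order $n$ with domination number $\gamma(G)=\gamma$. Let $0=\lambda_1(G)\leq\lambda_2(G)\leq\cdots\leq\lambda_n(G)$ be the eigenvalues of the Laplacian matrix of $G$. Then \[ \lambda_2(G)\leq\begin{cases} n & \text{if }\gamma=1,\\ n-\gamma & \text{if }\gamma\geq2.\end{cases} \] If $\gamma=1$, equality holds if and only if $G=K_n$. If $\gamma=2$, equality holds if and only if $G$ is the complement of a perfect matching. If $\gamma>2$, the inequality is always strict.
   Context: The Laplacian of $G$ is $D-A$, where $D$ is the diagonal matrix of vertex degrees and $A$ the adjacency matrix. A set $X\subseteq V(G)$ is dominating if every vertex $u\in V(G)\setminus X$ has a neighbor in $X$; the domination number $\gamma(G)$ is the minimum size of a dominating set.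
   Formalization: The final claim, strict inequality for γ>2, is proved only for graphs with at least one edge; it is false for the edgeless graph on n≥3 vertices, where γ=n and λ_2=0=n−γ. *)

theory Defs
  imports
    "Graph_Theory.Graph_Theory"
    "Jordan_Normal_Form.Char_Poly"
begin

text \<open>
  A finite simple graph is a digraph satisfying the locale predicate \<open>graph\<close> (finite, loop-free,
  without parallel arcs, symmetric); an undirected edge is a pair of opposite arcs. Hence
  \<open>u \<rightarrow>\<^bsub>G\<^esub> v\<close> is adjacency and \<open>out_degree G u\<close> is the degree of \<open>u\<close>.

  Matrices are indexed by natural numbers, so the matrices of a graph are taken with respect to a
  list \<open>vs\<close> enumerating the vertices; different enumerations give similar matrices.
\<close>

definition degree_mat :: "('a, 'b) pre_digraph \<Rightarrow> 'a list \<Rightarrow> real mat" where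
  "degree_mat G vs = mat (length vs) (length vs)
     (\<lambda>(i, j). if i = j then real (out_degree G (vs ! i)) else 0)"

definition adjacency_mat :: "('a, 'b) pre_digraph \<Rightarrow> 'a list \<Rightarrow> real mat" where
  "adjacency_mat G vs = mat (length vs) (length vs)
     (\<lambda>(i, j). if vs ! i \<rightarrow>\<^bsub>G\<^esub> vs ! j then 1 else 0)"

definition laplacian_mat :: "('a, 'b) pre_digraph \<Rightarrow> 'a list \<Rightarrow> real mat" where
  "laplacian_mat G vs = degree_mat G vs - adjacency_mat G vs"

text \<open>
  \<open>proots\<close> is the multiset of real roots with multiplicity. The Laplacian of a graph is real
  symmetric, so the list below has one entry per vertex.
\<close>

definition laplacian_eigenvalues :: "('a, 'b) pre_digraph \<Rightarrow> 'a list \<Rightarrow> real list" where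
  "laplacian_eigenvalues G vs =
     sorted_list_of_multiset (proots (char_poly (laplacian_mat G vs)))"

text \<open>The \<open>k\<close>-th smallest eigenvalue, counted from \<open>k = 1\<close>.\<close>

definition laplacian_eigenvalue :: "('a, 'b) pre_digraph \<Rightarrow> 'a list \<Rightarrow> nat \<Rightarrow> real" where
  "laplacian_eigenvalue G vs k = laplacian_eigenvalues G vs ! (k - 1)"

definition dominating_set :: "('a, 'b) pre_digraph \<Rightarrow> 'a set \<Rightarrow> bool" where
  "dominating_set G X \<longleftrightarrow>
     X \<subseteq> verts G \<and> (\<forall>u \<in> verts G - X. \<exists>x \<in> X. u \<rightarrow>\<^bsub>G\<^esub> x)"

definition domination_number :: "('a, 'b) pre_digraph \<Rightarrow> nat" where
  "domination_number G = Min (card ` {X. dominating_set G X})"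

definition perfect_matching_on :: "'a set \<Rightarrow> 'a set set \<Rightarrow> bool" where
  "perfect_matching_on V M \<longleftrightarrow>
     (\<forall>e \<in> M. e \<subseteq> V \<and> card e = 2) \<and> (\<forall>v \<in> V. \<exists>!e. e \<in> M \<and> v \<in> e)"

definition complement_of_perfect_matching :: "('a, 'b) pre_digraph \<Rightarrow> bool" where
  "complement_of_perfect_matching G \<longleftrightarrow>
     (\<exists>M. perfect_matching_on (verts G) M \<and>
       (\<forall>u \<in> verts G. \<forall>v \<in> verts G. u \<noteq> v \<longrightarrow> (u \<rightarrow>\<^bsub>G\<^esub> v \<longleftrightarrow> {u, v} \<notin> M)))"

text \<open>
  The edgeless graph on \<open>n \<ge> 2\<close> vertices has domination number \<open>n\<close> and second Laplacian
  eigenvalue \<open>0 = n - n\<close>. For \<open>n \<ge> 3\<close> the inequality is therefore not strict for this graph,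
  and a strictness claim for domination number above 2 has to exclude it.
\<close>

lemma edgeless_domination_number:
  assumes "graph G" "arcs G = {}"
  shows "domination_number G = card (verts G)"
proof -
  have "arcs_ends G = {}"
    using assms(2) by (simp add: arcs_ends_def)
  then have "{X. dominating_set G X} = {verts G}"
    by (auto simp: dominating_set_def)
  then show ?thesis
    by (simp add: domination_number_def)
qed

lemma edgeless_laplacian_eigenvalue_2:
  assumes "arcs G = {}" "length vs \<ge> 2"
  shows "laplacian_eigenvalue G vs 2 = 0"
proof -
  define n where "n = length vs"
  have "arcs_ends G = {}"
    using assms(1) by (simp add: arcs_ends_def)
  then have L: "laplacian_mat G vs = 0\<^sub>m n n"
    using assms(1)
    by (intro eq_matI) (auto simp: laplacian_mat_def degree_mat_def adjacency_mat_def
        out_degree_def out_arcs_def n_def)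
  have "char_poly (0\<^sub>m n n :: real mat) = (\<Prod>a \<leftarrow> diag_mat (0\<^sub>m n n :: real mat). [:- a, 1:])"
    by (rule char_poly_upper_triangular[of _ n]) auto
  also have "diag_mat (0\<^sub>m n n :: real mat) = replicate n 0"
    by (auto simp: diag_mat_def intro: nth_equalityI)
  finally have "char_poly (0\<^sub>m n n :: real mat) = [:0, 1:] ^ n"
    by simp
  then have "proots (char_poly (laplacian_mat G vs)) = repeat_mset n {#0#}"
    by (simp add: L proots_power)
  then have "laplacian_eigenvalues G vs = sorted_list_of_multiset (mset (replicate n 0))"
    by (simp add: laplacian_eigenvalues_def)
  then have "laplacian_eigenvalues G vs = replicate n 0"
    by (simp only: sorted_list_of_multiset_mset sorted_sort_id[OF sorted_replicate])
  then show ?thesis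
    using assms(2) by (simp add: laplacian_eigenvalue_def n_def)
qed

end

theory Submission
  imports Defs "Jordan_Normal_Form.Spectral_Radius"
begin

text \<open>
  Let \<open>H\<close> be the complement of \<open>G\<close> and \<open>m = n - \<mu>\<^sub>2\<close>. On vectors of sum zero the Laplacian form of \<open>G\<close> is
  \<open>n |f|\<^sup>2\<close> minus the Laplacian form of \<open>H\<close>, so \<open>m\<close> is the largest Laplacian eigenvalue of \<open>H\<close>, which
  exceeds every positive vertex degree of \<open>H\<close> by at least \<open>1\<close> and is at most twice the maximum degree.
  Fewer than \<open>\<gamma>\<close> vertices do not dominate \<open>G\<close>, hence have a common neighbour in \<open>H\<close>; growing a
  clique greedily, \<open>H\<close> contains a clique of size \<open>\<gamma>\<close>, so it has a vertex of degree at least \<open>\<gamma> - 1\<close>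
  and \<open>m \<ge> \<gamma>\<close> when \<open>\<gamma> \<ge> 2\<close>. If \<open>m = \<gamma>\<close>, then no degree of \<open>H\<close> exceeds \<open>\<gamma> - 1\<close>: for \<open>\<gamma> = 2\<close>,
  \<open>H\<close> is a perfect matching; for \<open>\<gamma> > 2\<close>, the clique is a component of \<open>H\<close> and must be all of it.
\<close>

section \<open>Real symmetric matrices\<close>

lemma symmetric_scalar_prod:
  fixes A :: "real mat"
  assumes "A \<in> carrier_mat n n" "A\<^sup>T = A" "x \<in> carrier_vec n" "y \<in> carrier_vec n"
  shows "(A *\<^sub>v x) \<bullet> y = x \<bullet> (A *\<^sub>v y)"
  using transpose_vec_mult_scalar[OF assms(1,4,3)] assms(2) by simp

lemma real_scalar_prod_self:
  fixes x :: "real vec"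
  assumes "x \<in> carrier_vec n"
  shows "x \<bullet> x \<ge> 0" "x \<bullet> x = 0 \<longleftrightarrow> x = 0\<^sub>v n"
proof -
  have "x \<bullet> x = (\<Sum>i<n. (x $ i)\<^sup>2)"
    using assms by (simp add: scalar_prod_def power2_eq_square atLeast0LessThan)
  then show "x \<bullet> x \<ge> 0" "x \<bullet> x = 0 \<longleftrightarrow> x = 0\<^sub>v n"
    using assms by (auto simp: sum_nonneg sum_nonneg_eq_0_iff intro!: eq_vecI)
qed

text \<open>Splitting a complex eigenvector into \<open>x + \<i> y\<close> and its eigenvalue into \<open>\<alpha> + \<i> \<beta>\<close>,
  symmetry gives \<open>\<beta> (|x|\<^sup>2 + |y|\<^sup>2) = 0\<close>; so \<open>\<beta> = 0\<close>, and \<open>x\<close> or \<open>y\<close> is a real eigenvector.\<close>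

lemma real_symmetric_eigenvector:
  fixes A :: "real mat"
  assumes A: "A \<in> carrier_mat n n" and sym: "A\<^sup>T = A" and n: "n > 0"
  obtains e v where "v \<in> carrier_vec n" "v \<noteq> 0\<^sub>v n" "A *\<^sub>v v = e \<cdot>\<^sub>v v"
proof -
  let ?B = "map_mat complex_of_real A"
  have B: "?B \<in> carrier_mat n n" using A by simp
  from spectrum_non_empty[OF B n] obtain k where "eigenvalue ?B k"
    by (auto simp: spectrum_def)
  then obtain z where z: "z \<in> carrier_vec n" "z \<noteq> 0\<^sub>v n" and ev: "?B *\<^sub>v z = k \<cdot>\<^sub>v z"
    using A by (auto simp: eigenvalue_def eigenvector_def)
  define x where "x = map_vec Re z"
  define y where "y = map_vec Im z"
  have x: "x \<in> carrier_vec n" and y: "y \<in> carrier_vec n"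
    using z by (auto simp: x_def y_def)
  have idx: "(\<Sum>j<n. complex_of_real (A $$ (i,j)) * z $ j) = k * z $ i" if "i < n" for i
    using arg_cong[OF ev, of "\<lambda>v. v $ i"] that A z
    by (simp add: scalar_prod_def atLeast0LessThan)
  have Ax: "A *\<^sub>v x = Re k \<cdot>\<^sub>v x - Im k \<cdot>\<^sub>v y"
  proof (rule eq_vecI)
    fix i assume "i < dim_vec (Re k \<cdot>\<^sub>v x - Im k \<cdot>\<^sub>v y)"
    then have i: "i < n" using x y by simp
    have "(\<Sum>j<n. A $$ (i,j) * Re (z $ j)) = Re (k * z $ i)"
      using arg_cong[OF idx[OF i], of Re] by simp
    then show "(A *\<^sub>v x) $ i = (Re k \<cdot>\<^sub>v x - Im k \<cdot>\<^sub>v y) $ i"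
      using i A z by (simp add: scalar_prod_def atLeast0LessThan x_def y_def)
  qed (use A x y in auto)
  have Ay: "A *\<^sub>v y = Re k \<cdot>\<^sub>v y + Im k \<cdot>\<^sub>v x"
  proof (rule eq_vecI)
    fix i assume "i < dim_vec (Re k \<cdot>\<^sub>v y + Im k \<cdot>\<^sub>v x)"
    then have i: "i < n" using x y by simp
    have "(\<Sum>j<n. A $$ (i,j) * Im (z $ j)) = Im (k * z $ i)"
      using arg_cong[OF idx[OF i], of Im] by simp
    then show "(A *\<^sub>v y) $ i = (Re k \<cdot>\<^sub>v y + Im k \<cdot>\<^sub>v x) $ i"
      using i A z by (simp add: scalar_prod_def atLeast0LessThan x_def y_def)
  qed (use A x y in auto)
  have xy: "x \<bullet> y = y \<bullet> x"
    by (rule comm_scalar_prod[OF x y])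
  have "(A *\<^sub>v x) \<bullet> y = x \<bullet> (A *\<^sub>v y)"
    by (rule symmetric_scalar_prod[OF A sym x y])
  then have "Im k * (x \<bullet> x + y \<bullet> y) = 0"
    unfolding Ax Ay using x y xy
    by (simp add: minus_scalar_prod_distrib[of _ n] scalar_prod_add_distrib[of _ n] algebra_simps)
  moreover have ne: "x \<noteq> 0\<^sub>v n \<or> y \<noteq> 0\<^sub>v n"
  proof (rule ccontr)
    assume "\<not> ?thesis"
    then have "x $ i = 0" "y $ i = 0" if "i < n" for i
      using that by auto
    then have "Re (z $ i) = 0 \<and> Im (z $ i) = 0" if "i < n" for i
      using that z(1) by (simp add: x_def y_def)
    then have "z = 0\<^sub>v n"
      using z(1) by (intro eq_vecI) (auto simp: complex_eq_iff)
    with z(2) show False by simp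
  qed
  ultimately have "Im k = 0"
    using real_scalar_prod_self[OF x] real_scalar_prod_self[OF y]
    by (smt (verit) mult_eq_0_iff)
  then have "A *\<^sub>v x = Re k \<cdot>\<^sub>v x" "A *\<^sub>v y = Re k \<cdot>\<^sub>v y"
    using Ax Ay x y by auto
  with ne x y that show ?thesis by blast
qed

text \<open>Gram-Schmidt on a basis that starts with \<open>v\<close> keeps \<open>v\<close> in
  first place. Rescaling all vectors to length 1 makes the matrix orthogonal, and \<open>c\<close>
  is the reciprocal of the length of \<open>v\<close>.\<close>

lemma orthogonal_mat_extension:
  fixes v :: "real vec"
  assumes v: "v \<in> carrier_vec n" "v \<noteq> 0\<^sub>v n"
  obtains W c where "W \<in> carrier_mat n n" "W\<^sup>T * W = 1\<^sub>m n" "col W 0 = c \<cdot>\<^sub>v v"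
proof -
  interpret cof_vec_space n "TYPE(real)" .
  have n: "n > 0" using v by (cases n) (auto intro: eq_vecI)
  define b where "b = basis_completion v"
  define ws where "ws = gram_schmidt n b"
  note bc = basis_completion[OF v, folded b_def]
  from bc(6,7) n obtain vs where bv: "b = v # vs" by (cases b) auto
  note gs = gram_schmidt_result[OF bc(2,4,5) ws_def]
  have len: "length ws = n" using gs(4) bc(6) by simp
  have hd: "ws ! 0 = v"
    using gram_schmidt_hd[OF v(1), of vs] len n hd_conv_nth[of ws]
    unfolding bv[symmetric] ws_def[symmetric] by auto
  have orth: "(ws ! i \<bullet> ws ! j = 0) = (i \<noteq> j)" if "i < n" "j < n" for i j
    using corthogonalD[OF gs(2), of i j] that len by simp
  have ws: "ws ! i \<in> carrier_vec n" if "i < n" for i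
    using gs(3) that len by auto
  define s where "s i = 1 / sqrt (ws ! i \<bullet> ws ! i)" for i
  define W where "W = mat_of_cols n (map (\<lambda>i. s i \<cdot>\<^sub>v ws ! i) [0..<n])"
  have W: "W \<in> carrier_mat n n"
    by (simp add: W_def mat_of_cols_def)
  have col: "col W i = s i \<cdot>\<^sub>v ws ! i" if "i < n" for i
    using that ws[OF that] unfolding W_def by (subst col_mat_of_cols) auto
  have "W\<^sup>T * W = 1\<^sub>m n"
  proof (rule eq_matI)
    fix i j assume "i < dim_row (1\<^sub>m n :: real mat)" "j < dim_col (1\<^sub>m n :: real mat)"
    then have ij: "i < n" "j < n" by auto
    have "(W\<^sup>T * W) $$ (i, j) = s i * s j * (ws ! i \<bullet> ws ! j)"
      using ij W smult_scalar_prod_distrib[OF ws ws, of i j "s i"]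
        scalar_prod_smult_distrib[OF _ ws, of "s i \<cdot>\<^sub>v ws ! i" j "s j"] ws[of i]
      by (simp add: col)
    also have "\<dots> = (1\<^sub>m n :: real mat) $$ (i, j)"
      using orth[of i j] ij real_scalar_prod_self(1)[OF ws[of i]]
      by (auto simp: s_def real_sqrt_mult_self)
    finally show "(W\<^sup>T * W) $$ (i, j) = (1\<^sub>m n :: real mat) $$ (i, j)" .
  qed (use W in auto)
  with W col[OF n] hd that show ?thesis by metis
qed

text \<open>Spectral theorem by deflation: in an orthonormal basis whose first vector is an
  eigenvector, a symmetric matrix splits into a 1 by 1 block and a smaller symmetric block, to which
  the induction hypothesis applies.\<close>

theorem real_symmetric_diagonalization:
  fixes A :: "real mat"
  assumes "A \<in> carrier_mat n n" "A\<^sup>T = A"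
  shows "\<exists>P D. P \<in> carrier_mat n n \<and> D \<in> carrier_mat n n \<and> diagonal_mat D
    \<and> P\<^sup>T * P = 1\<^sub>m n \<and> A = P * D * P\<^sup>T"
  using assms
proof (induction n arbitrary: A)
  case 0
  then show ?case
    by (intro exI[of _ "1\<^sub>m 0"]) (auto simp: diagonal_mat_def)
next
  case (Suc k)
  let ?n = "Suc k"
  note A = Suc.prems(1) and sym = Suc.prems(2)
  obtain e v where v: "v \<in> carrier_vec ?n" "v \<noteq> 0\<^sub>v ?n" and ev: "A *\<^sub>v v = e \<cdot>\<^sub>v v"
    using real_symmetric_eigenvector[OF A sym] by blast
  obtain W c where W: "W \<in> carrier_mat ?n ?n" and WW: "W\<^sup>T * W = 1\<^sub>m ?n"
    and W0: "col W 0 = c \<cdot>\<^sub>v v"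
    using orthogonal_mat_extension[OF v] by blast
  have Wt: "W\<^sup>T \<in> carrier_mat ?n ?n" using W by simp
  have WW': "W * W\<^sup>T = 1\<^sub>m ?n"
    by (rule mat_mult_left_right_inverse[OF Wt W WW])
  define B where "B = W\<^sup>T * (A * W)"
  have AW: "A * W \<in> carrier_mat ?n ?n" using A W by simp
  have B: "B \<in> carrier_mat ?n ?n" using Wt AW by (simp add: B_def)
  have Bt: "B\<^sup>T = B"
    using A W Wt AW sym
    by (simp add: B_def transpose_mult[of _ ?n ?n _ ?n] assoc_mult_mat[of _ ?n ?n _ ?n _ ?n])
  have "A *\<^sub>v col W 0 = e \<cdot>\<^sub>v col W 0"
    unfolding W0 using v A ev by (simp add: mult_mat_vec smult_smult_assoc mult.commute)
  then have "col (A * W) 0 = e \<cdot>\<^sub>v col W 0"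
    using A W by (subst col_mult2[of _ ?n ?n _ ?n]) auto
  \<comment> \<open>Orthonormality turns \<open>W\<^sup>T\<close> times the first column of
    \<open>A * W\<close> into \<open>e\<close> times the first unit vector; symmetry of
    \<open>B\<close> then clears the first row as well.\<close>
  then have B0: "B $$ (i, 0) = (if i = 0 then e else 0)" if "i < ?n" for i
    using that W A arg_cong[OF WW, of "\<lambda>M. M $$ (i, 0)"]
    by (auto simp: B_def)
  have B0': "B $$ (0, i) = (if i = 0 then e else 0)" if "i < ?n" for i
    using B0[OF that] arg_cong[OF Bt, of "\<lambda>M. M $$ (i, 0)"] that B by auto
  define B4 where "B4 = mat k k (\<lambda>(i, j). B $$ (Suc i, Suc j))"
  define E where "E = mat 1 1 (\<lambda>_. e)"
  have B4: "B4 \<in> carrier_mat k k" and E: "E \<in> carrier_mat 1 1"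
    by (auto simp: B4_def E_def)
  have Bblock: "B = four_block_mat E (0\<^sub>m 1 k) (0\<^sub>m k 1) B4"
    using B by (intro eq_matI) (auto simp: B4_def E_def B0 B0')
  have "B4\<^sup>T = B4"
  proof (rule eq_matI)
    fix i j assume "i < dim_row B4" "j < dim_col B4"
    then show "B4\<^sup>T $$ (i, j) = B4 $$ (i, j)"
      using arg_cong[OF Bt, of "\<lambda>M. M $$ (Suc i, Suc j)"] B by (simp add: B4_def)
  qed (simp_all add: B4_def)
  from Suc.IH[OF B4 this] obtain Q D where Q: "Q \<in> carrier_mat k k" and D: "D \<in> carrier_mat k k"
    and diag: "diagonal_mat D" and QQ: "Q\<^sup>T * Q = 1\<^sub>m k" and B4eq: "B4 = Q * D * Q\<^sup>T" by blast
  \<comment> \<open>Padding \<open>Q\<close> by a leading 1 gives an orthogonal \<open>R\<close>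
    with \<open>B = R * F * R\<^sup>T\<close>, so \<open>W * R\<close> diagonalises
    \<open>A\<close>.\<close>
  define R where "R = four_block_mat (1\<^sub>m 1) (0\<^sub>m 1 k) (0\<^sub>m k 1) Q"
  define F where "F = four_block_mat E (0\<^sub>m 1 k) (0\<^sub>m k 1) D"
  have Rt: "R\<^sup>T = four_block_mat (1\<^sub>m 1) (0\<^sub>m 1 k) (0\<^sub>m k 1) Q\<^sup>T"
    unfolding R_def using Q by (subst transpose_four_block_mat[of _ 1 1 _ k _ k]) auto
  have R: "R \<in> carrier_mat ?n ?n" and F: "F \<in> carrier_mat ?n ?n" and Rtc: "R\<^sup>T \<in> carrier_mat ?n ?n"
    using Q D E by (auto simp: R_def F_def four_block_mat_def Let_def)
  have RR: "R\<^sup>T * R = 1\<^sub>m ?n"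
    unfolding Rt unfolding R_def using Q QQ
    by (subst mult_four_block_mat[of _ 1 1 _ k _ k _ _ 1 _ k]) auto
  have RF: "R * F = four_block_mat E (0\<^sub>m 1 k) (0\<^sub>m k 1) (Q * D)"
    unfolding R_def F_def using Q D E
    by (subst mult_four_block_mat[of _ 1 1 _ k _ k _ _ 1 _ k]) auto
  have BR: "B = R * F * R\<^sup>T"
    unfolding RF Rt Bblock B4eq using Q D E
    by (subst mult_four_block_mat[of _ 1 1 _ k _ k _ _ 1 _ k]) auto
  have diagF: "diagonal_mat F"
    using diag D E by (auto simp: F_def diagonal_mat_def)
  let ?P = "W * R"
  have "?P\<^sup>T * ?P = R\<^sup>T * ((W\<^sup>T * W) * R)"
    using W Wt R Rtc
    by (simp add: transpose_mult[of _ ?n ?n _ ?n] assoc_mult_mat[of _ ?n ?n _ ?n _ ?n])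
  also have "\<dots> = 1\<^sub>m ?n" using R RR by (simp add: WW)
  finally have PP: "?P\<^sup>T * ?P = 1\<^sub>m ?n" .
  have "?P * F * ?P\<^sup>T = W * B * W\<^sup>T"
    unfolding BR using W Wt R Rtc F
    by (simp add: transpose_mult[of _ ?n ?n _ ?n] assoc_mult_mat[of _ ?n ?n _ ?n _ ?n])
  also have "\<dots> = (W * W\<^sup>T) * A * (W * W\<^sup>T)"
    unfolding B_def using W Wt A
    by (simp add: assoc_mult_mat[of _ ?n ?n _ ?n _ ?n])
  also have "\<dots> = A" using A by (simp add: WW')
  finally show ?case
    using PP W R F diagF by (intro exI[of _ ?P] exI[of _ F]) auto
qed

section \<open>The second smallest eigenvalue of a symmetric matrix\<close>

lemma proots_prod_list_linear: "proots (\<Prod>a\<leftarrow>as. [:- a, 1:]) = mset (as :: real list)"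
proof (induction as)
  case (Cons a as)
  have "(\<Prod>a\<leftarrow>as. [:- a, 1:]) \<noteq> 0" by (auto simp: prod_list_zero_iff)
  then show ?case using Cons by (simp add: proots_mult del: mult_pCons_left)
qed simp

text \<open>Index 1 is the second smallest eigenvalue counted with multiplicity. The last conclusion
  is the half of Courant-Fischer used later: on the orthogonal complement of a first eigenvector the
  Rayleigh quotient is at least \<open>l\<close>.\<close>

lemma second_eigenvalue_of_symmetric:
  fixes A :: "real mat"
  assumes A: "A \<in> carrier_mat n n" and sym: "A\<^sup>T = A" and n: "n \<ge> 2"
  defines "l \<equiv> sorted_list_of_multiset (proots (char_poly A)) ! 1"
  obtains u w \<mu> where "u \<in> carrier_vec n" "w \<in> carrier_vec n"
    "u \<bullet> u = 1" "w \<bullet> w = 1" "u \<bullet> w = 0"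
    "A *\<^sub>v u = \<mu> \<cdot>\<^sub>v u" "A *\<^sub>v w = l \<cdot>\<^sub>v w" "\<mu> \<le> l"
    "\<And>x. x \<in> carrier_vec n \<Longrightarrow> u \<bullet> x = 0 \<Longrightarrow> l * (x \<bullet> x) \<le> x \<bullet> (A *\<^sub>v x)"
proof -
  obtain P D where P: "P \<in> carrier_mat n n" and D: "D \<in> carrier_mat n n" and diag: "diagonal_mat D"
    and PP: "P\<^sup>T * P = 1\<^sub>m n" and AP: "A = P * D * P\<^sup>T"
    using real_symmetric_diagonalization[OF A sym] by blast
  have Pt: "P\<^sup>T \<in> carrier_mat n n" using P by simp
  have PP': "P * P\<^sup>T = 1\<^sub>m n" by (rule mat_mult_left_right_inverse[OF Pt P PP])
  define ds where "ds = diag_mat D"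
  have len: "length ds = n" using D by (simp add: ds_def diag_mat_def)
  have dsi: "ds ! i = D $$ (i, i)" if "i < n" for i
    using that D by (simp add: ds_def diag_mat_def)
  have "similar_mat A D"
    using P Pt A D PP PP' AP by (intro similar_matI[of _ _ P "P\<^sup>T" n]) auto
  then have "char_poly A = (\<Prod>a\<leftarrow>ds. [:- a, 1:])"
    using char_poly_similar char_poly_upper_triangular[of D n] D diag
    by (metis diagonal_mat_def ds_def upper_triangular_def carrier_matD less_imp_neq less_trans)
  then have l: "l = sort ds ! 1"
    by (simp add: l_def proots_prod_list_linear sorted_list_of_multiset_mset)
  \<comment> \<open>Positions rather than values are tracked: the columns \<open>p 0\<close> and
    \<open>p 1\<close> of \<open>P\<close> are distinct eigenvectors even if the two smallest
    eigenvalues coincide.\<close>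
  obtain p where p: "p permutes {..<n}" and pds: "permute_list p ds = sort ds"
    using mset_eq_permutation[of "sort ds" ds] len by auto
  have dp: "ds ! p i = sort ds ! i" if "i < n" for i
    using permute_list_nth[of p ds i] p len pds that by simp
  have pn: "p i < n" if "i < n" for i
    using permutes_in_image[OF p, of i] that by simp
  have srt: "sort ds ! i \<le> sort ds ! j" if "i \<le> j" "j < n" for i j
    using sorted_nth_mono[of "sort ds" i j] that len by simp
  have eig: "A *\<^sub>v col P i = ds ! i \<cdot>\<^sub>v col P i" if i: "i < n" for i
  proof -
    have "A * P = P * D"
      unfolding AP using P Pt D PP by (simp add: assoc_mult_mat[of _ n n _ n _ n])
    then have "A *\<^sub>v col P i = P *\<^sub>v col D i"
      using col_mult2[OF A P i] col_mult2[OF P D i] by simp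
    also have "col D i = ds ! i \<cdot>\<^sub>v unit_vec n i"
      using D diag i by (intro eq_vecI) (auto simp: dsi diagonal_mat_def)
    also have "P *\<^sub>v \<dots> = ds ! i \<cdot>\<^sub>v col P i"
      using P i by (intro eq_vecI) (auto simp: scalar_prod_right_unit)
    finally show ?thesis .
  qed
  have orth: "col P i \<bullet> col P j = (if i = j then 1 else 0)" if "i < n" "j < n" for i j
    using arg_cong[OF PP, of "\<lambda>M. M $$ (i, j)"] that P by simp
  have colP: "col P i \<in> carrier_vec n" for i
    using P by auto
  have ray: "l * (x \<bullet> x) \<le> x \<bullet> (A *\<^sub>v x)"
    if x: "x \<in> carrier_vec n" and ux: "col P (p 0) \<bullet> x = 0" for x
  proof -
    \<comment> \<open>Coordinates of \<open>x\<close> in the orthonormal eigenbasis; the one at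
      \<open>p 0\<close> vanishes by assumption, and all others belong to eigenvalues at least
      \<open>l\<close>.\<close>
    define c where "c = P\<^sup>T *\<^sub>v x"
    have c: "c \<in> carrier_vec n" using Pt x by (simp add: c_def)
    have ci: "c $ i = col P i \<bullet> x" if "i < n" for i
      using that P by (simp add: c_def)
    have xPy: "x \<bullet> (P *\<^sub>v y) = c \<bullet> y" if "y \<in> carrier_vec n" for y
      using transpose_vec_mult_scalar[OF P that x] by (simp add: c_def)
    have "P *\<^sub>v c = x"
      unfolding c_def using P Pt x PP' by (simp add: assoc_mult_mat_vec[symmetric, of _ n n _ n])
    then have xx: "x \<bullet> x = (\<Sum>i<n. (c $ i)\<^sup>2)"
      using xPy[OF c] c by (simp add: scalar_prod_def power2_eq_square atLeast0LessThan)
    have Dc: "(D *\<^sub>v c) $ i = ds ! i * c $ i" if i: "i < n" for i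
    proof -
      have "(D *\<^sub>v c) $ i = (\<Sum>j<n. D $$ (i, j) * c $ j)"
        using i D c by (simp add: scalar_prod_def atLeast0LessThan)
      also have "\<dots> = (\<Sum>j<n. if j = i then ds ! i * c $ i else 0)"
        using diag D i by (intro sum.cong) (auto simp: diagonal_mat_def dsi)
      finally show ?thesis using i by simp
    qed
    have "A *\<^sub>v x = P *\<^sub>v (D *\<^sub>v c)"
      unfolding AP c_def using P Pt D x by (simp add: assoc_mult_mat_vec[of _ n n _ n])
    then have "x \<bullet> (A *\<^sub>v x) = c \<bullet> (D *\<^sub>v c)"
      using xPy[of "D *\<^sub>v c"] D c by simp
    also have "\<dots> = (\<Sum>i<n. c $ i * (D *\<^sub>v c) $ i)"
      using D by (simp add: scalar_prod_def atLeast0LessThan)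
    also have "\<dots> = (\<Sum>i<n. ds ! i * (c $ i)\<^sup>2)"
      by (intro sum.cong) (auto simp: Dc power2_eq_square)
    finally have xAx: "x \<bullet> (A *\<^sub>v x) = (\<Sum>i<n. ds ! i * (c $ i)\<^sup>2)" .
    have "l * (c $ i)\<^sup>2 \<le> ds ! i * (c $ i)\<^sup>2" if i: "i < n" for i
    proof (cases "i = p 0")
      case True
      then show ?thesis using ci[OF i] ux by simp
    next
      case False
      obtain j where j: "i = p j" using permutes_surj[OF p] by (metis surjD)
      then have "j < n" using permutes_in_image[OF p, of j] i by simp
      moreover from j False have "j \<noteq> 0" by metis
      ultimately have "l \<le> ds ! i"
        unfolding l j using dp[of j] srt[of 1 j] by simp
      then show ?thesis by (simp add: mult_right_mono)
    qed
    then show ?thesis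
      unfolding xx xAx sum_distrib_left by (intro sum_mono) auto
  qed
  have "p 0 \<noteq> p 1" using permutes_inj[OF p] by (metis injD zero_neq_one)
  then show ?thesis
    using that[of "col P (p 0)" "col P (p 1)" "ds ! p 0"] colP orth eig pn n ray srt[of 0 1]
      dp[of 0] dp[of 1] l by simp
qed

section \<open>The Laplacian form of the complement\<close>

text \<open>Adjacency in the complement, which is never built as a digraph. Membership in
  \<open>verts G\<close> is left to the places of use.\<close>

definition co_adj :: "('a, 'b) pre_digraph \<Rightarrow> 'a \<Rightarrow> 'a \<Rightarrow> bool" where
  "co_adj G u v \<longleftrightarrow> u \<noteq> v \<and> \<not> u \<rightarrow>\<^bsub>G\<^esub> v"

definition co_nbrs :: "('a, 'b) pre_digraph \<Rightarrow> 'a \<Rightarrow> 'a set" where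
  "co_nbrs G u = {v \<in> verts G. co_adj G u v}"

text \<open>The quadratic form of the Laplacian of the complement; halving compensates for each edge
  being summed in both directions.\<close>

definition co_energy :: "('a, 'b) pre_digraph \<Rightarrow> ('a \<Rightarrow> real) \<Rightarrow> real" where
  "co_energy G f =
     (\<Sum>u\<in>verts G. \<Sum>v\<in>verts G. of_bool (co_adj G u v) * (f u - f v)\<^sup>2) / 2"

lemma co_energy_nonneg: "co_energy G f \<ge> 0"
  by (simp add: co_energy_def sum_nonneg)

lemma co_energy_affine: "co_energy G (\<lambda>v. a + b * f v) = b\<^sup>2 * co_energy G f"
proof -
  have "((a + b * f u) - (a + b * f v))\<^sup>2 = b\<^sup>2 * (f u - f v)\<^sup>2" for u v
    by (simp add: power2_eq_square algebra_simps)
  then show ?thesis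
    by (simp add: co_energy_def sum_distrib_left mult.left_commute)
qed

text \<open>Half of either side is the Laplacian form of the complete graph on \<open>V\<close>; for
  \<open>f\<close> of sum zero it is \<open>card V\<close> times the squared norm.\<close>

lemma sum_sum_sq_diff:
  fixes f :: "'a \<Rightarrow> real"
  shows "(\<Sum>u\<in>V. \<Sum>v\<in>V. (f u - f v)\<^sup>2) = 2 * (card V * (\<Sum>v\<in>V. (f v)\<^sup>2) - (\<Sum>v\<in>V. f v)\<^sup>2)"
proof -
  have "(\<Sum>u\<in>V. \<Sum>v\<in>V. (f u - f v)\<^sup>2)
      = (\<Sum>u\<in>V. \<Sum>v\<in>V. (f u)\<^sup>2 + (f v)\<^sup>2 - 2 * (f u * f v))"
    by (simp add: power2_diff mult.assoc)
  also have "\<dots> = 2 * (card V * (\<Sum>v\<in>V. (f v)\<^sup>2)) - 2 * (\<Sum>u\<in>V. \<Sum>v\<in>V. f u * f v)"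
    by (simp add: sum.distrib sum_subtractf sum_distrib_left)
  also have "(\<Sum>u\<in>V. \<Sum>v\<in>V. f u * f v) = (\<Sum>v\<in>V. f v)\<^sup>2"
    by (simp add: power2_eq_square sum_product)
  finally show ?thesis by (simp add: algebra_simps)
qed

lemma (in graph) co_adj_commute: "co_adj G u v \<longleftrightarrow> co_adj G v u"
  using arcs_ends_symmetric[OF sym_arcs] by (auto simp: co_adj_def)

lemma (in graph) finite_co_nbrs [simp]: "finite (co_nbrs G u)"
  by (simp add: co_nbrs_def)

text \<open>Without parallel arcs, \<open>head G\<close> is injective on the arcs leaving
  \<open>u\<close>, so counting arcs counts neighbours.\<close>

lemma (in graph) out_degree_sum:
  "real (out_degree G u) = (\<Sum>v\<in>verts G. of_bool (u \<rightarrow>\<^bsub>G\<^esub> v))"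
proof -
  have "bij_betw (head G) (out_arcs G u) {v \<in> verts G. u \<rightarrow>\<^bsub>G\<^esub> v}"
    unfolding bij_betw_def
  proof
    show "inj_on (head G) (out_arcs G u)"
      by (rule inj_onI) (auto intro: no_multi_arcs simp: arc_to_ends_def)
    show "head G ` out_arcs G u = {v \<in> verts G. u \<rightarrow>\<^bsub>G\<^esub> v}"
      by (auto simp: arcs_ends_conv)
  qed
  then show ?thesis
    by (simp add: out_degree_def bij_betw_same_card Int_def)
qed

text \<open>The test function of a star: \<open>d\<close> at \<open>v\<close>, -1 at its neighbours
  in the complement, 0 elsewhere. Each of the \<open>d\<close> complement edges at \<open>v\<close>
  contributes \<open>(d + 1)\<^sup>2\<close>, so for \<open>d > 0\<close> the Rayleigh quotient is
  at least \<open>d + 1\<close>.\<close>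

lemma (in graph) co_energy_star:
  assumes v: "v \<in> verts G"
  defines "d \<equiv> card (co_nbrs G v)"
  obtains f where "(\<Sum>u\<in>verts G. f u) = 0" "(\<Sum>u\<in>verts G. (f u)\<^sup>2) = real d * (real d + 1)"
    "co_energy G f \<ge> real d * (real d + 1)\<^sup>2"
proof -
  define f :: "'a \<Rightarrow> real" where "f u = (if u = v then d else - of_bool (co_adj G v u))" for u
  let ?V = "verts G" and ?N = "co_nbrs G v"
  have irr: "\<not> co_adj G v v" by (simp add: co_adj_def)
  have cnt: "(\<Sum>u\<in>?V - {v}. of_bool (co_adj G v u)) = real d"
  proof -
    have "?N = {u \<in> ?V - {v}. co_adj G v u}"
      using irr by (auto simp: co_nbrs_def)
    then show ?thesis by (simp add: d_def Int_def conj_commute)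
  qed
  have 1: "(\<Sum>u\<in>?V. f u) = 0"
    using cnt by (simp add: sum.remove[OF finite_verts v] f_def sum_negf)
  have 2: "(\<Sum>u\<in>?V. (f u)\<^sup>2) = real d * (real d + 1)"
  proof -
    have "(\<Sum>u\<in>?V - {v}. (f u)\<^sup>2) = (\<Sum>u\<in>?V - {v}. of_bool (co_adj G v u))"
      by (intro sum.cong) (auto simp: f_def)
    then show ?thesis
      using cnt by (simp add: sum.remove[OF finite_verts v] f_def power2_eq_square algebra_simps)
  qed
  let ?t = "\<lambda>u w. of_bool (co_adj G u w) * (f u - f w)\<^sup>2"
  have row: "(\<Sum>w\<in>?V - {v}. ?t v w) = real d * (real d + 1)\<^sup>2"
  proof -
    have "(\<Sum>w\<in>?V - {v}. ?t v w) = (\<Sum>w\<in>?V - {v}. of_bool (co_adj G v w) * (real d + 1)\<^sup>2)"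
      by (intro sum.cong) (auto simp: f_def)
    then show ?thesis using cnt by (simp add: sum_distrib_right[symmetric])
  qed
  have "(\<Sum>u\<in>?V - {v}. ?t u v) = (\<Sum>w\<in>?V - {v}. ?t v w)"
    by (intro sum.cong refl) (simp only: co_adj_commute power2_commute)
  moreover have "(\<Sum>w\<in>?V. ?t v w) = (\<Sum>w\<in>?V - {v}. ?t v w)"
    using sum.remove[OF finite_verts v, of "?t v"] irr by simp
  ultimately have "2 * (\<Sum>w\<in>?V - {v}. ?t v w) = (\<Sum>w\<in>?V. ?t v w) + (\<Sum>u\<in>?V - {v}. ?t u v)"
    by linarith
  \<comment> \<open>From each row other than that of \<open>v\<close> only the entry in column
    \<open>v\<close> was kept; the terms added here are nonnegative.\<close>
  also have "\<dots> \<le> (\<Sum>w\<in>?V. ?t v w) + (\<Sum>u\<in>?V - {v}. \<Sum>w\<in>?V. ?t u w)"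
    using v by (intro add_left_mono sum_mono member_le_sum) auto
  also have "\<dots> = 2 * co_energy G f"
    using sum.remove[OF finite_verts v, of "\<lambda>u. \<Sum>w\<in>?V. ?t u w"] by (simp add: co_energy_def)
  finally have "co_energy G f \<ge> real d * (real d + 1)\<^sup>2"
    using row by simp
  with 1 2 that show ?thesis by blast
qed

text \<open>Each edge term satisfies \<open>(f u - f v)\<^sup>2 \<le> 2 * (f u)\<^sup>2 + 2 * (f
  v)\<^sup>2\<close>, and summing over the edges weights each vertex by its degree. This bounds the
  largest Laplacian eigenvalue by twice the maximum degree.\<close>

lemma (in graph) co_energy_le_degree:
  "co_energy G f \<le> 2 * (\<Sum>u\<in>verts G. card (co_nbrs G u) * (f u)\<^sup>2)"
  for f :: "'a \<Rightarrow> real"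
proof -
  let ?V = "verts G"
  let ?c = "\<lambda>u v. of_bool (co_adj G u v) :: real"
  have deg: "(\<Sum>v\<in>?V. ?c u v) = card (co_nbrs G u)" for u
    by (simp add: co_nbrs_def Int_def)
  have sq: "(f u - f v)\<^sup>2 \<le> 2 * (f u)\<^sup>2 + 2 * (f v)\<^sup>2" for u v
    using zero_le_power2[of "f u + f v"] by (simp add: power2_eq_square algebra_simps)
  have "2 * co_energy G f \<le> (\<Sum>u\<in>?V. \<Sum>v\<in>?V. ?c u v * (2 * (f u)\<^sup>2 + 2 * (f v)\<^sup>2))"
    unfolding co_energy_def using sq
    by (auto intro!: sum_mono mult_left_mono simp del: sum_of_bool_mult_eq)
  also have "\<dots> = 2 * (\<Sum>u\<in>?V. \<Sum>v\<in>?V. ?c u v * (f u)\<^sup>2) + 2 * (\<Sum>u\<in>?V. \<Sum>v\<in>?V. ?c u v * (f v)\<^sup>2)"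
    by (simp add: distrib_left sum.distrib sum_distrib_left mult.left_commute
        del: sum_of_bool_mult_eq)
  also have "(\<Sum>u\<in>?V. \<Sum>v\<in>?V. ?c u v * (f v)\<^sup>2) = (\<Sum>u\<in>?V. \<Sum>v\<in>?V. ?c u v * (f u)\<^sup>2)"
    by (subst sum.swap) (simp add: co_adj_commute)
  also have "(\<Sum>u\<in>?V. \<Sum>v\<in>?V. ?c u v * (f u)\<^sup>2) = (\<Sum>u\<in>?V. card (co_nbrs G u) * (f u)\<^sup>2)"
    by (simp add: sum_distrib_right[symmetric] deg)
  finally show ?thesis by simp
qed

section \<open>The Laplacian matrix as an operator on functions on the vertices\<close>

locale enumerated_graph = graph G for G :: "('a, 'b) pre_digraph" +
  fixes vs :: "'a list"
  assumes distinct_vs: "distinct vs" and set_vs: "set vs = verts G"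
    and two_verts: "length vs \<ge> 2"
begin

abbreviation "n \<equiv> length vs"
abbreviation "L \<equiv> laplacian_mat G vs"
abbreviation "\<mu>\<^sub>2 \<equiv> laplacian_eigenvalue G vs 2"

definition vec_of :: "('a \<Rightarrow> real) \<Rightarrow> real vec" where
  "vec_of f = vec n (\<lambda>i. f (vs ! i))"

lemma card_verts: "card (verts G) = n"
  using distinct_card[OF distinct_vs] by (simp add: set_vs)

lemma sum_nth: "(\<Sum>i<n. g (vs ! i)) = (\<Sum>v\<in>verts G. g v)"
  using sum.reindex_bij_betw[OF bij_betw_nth[OF distinct_vs refl refl], of g] by (simp add: set_vs)

lemma L_carrier: "L \<in> carrier_mat n n"
  by (rule carrier_matI) (simp_all add: laplacian_mat_def degree_mat_def adjacency_mat_def)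

lemma L_sym: "L\<^sup>T = L"
  using arcs_ends_symmetric[OF sym_arcs]
  by (intro eq_matI) (auto simp: laplacian_mat_def degree_mat_def adjacency_mat_def)

lemma vec_of_carrier [simp]: "vec_of f \<in> carrier_vec n"
  by (simp add: vec_of_def)

lemma vec_of_surj:
  assumes "x \<in> carrier_vec n"
  obtains f where "x = vec_of f"
proof
  show "x = vec_of (\<lambda>v. x $ inv_into {..<n} ((!) vs) v)"
    using assms distinct_vs
    by (intro eq_vecI) (auto simp: vec_of_def inv_into_f_f inj_on_nth)
qed

lemma vec_of_scalar_prod: "vec_of f \<bullet> vec_of g = (\<Sum>v\<in>verts G. f v * g v)" for f g :: "'a \<Rightarrow> real"
  using sum_nth[of "\<lambda>v. f v * g v"] by (simp add: vec_of_def scalar_prod_def atLeast0LessThan)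

lemma L_vec_of: "L *\<^sub>v vec_of f = vec_of (\<lambda>u. \<Sum>v\<in>verts G. of_bool (u \<rightarrow>\<^bsub>G\<^esub> v) * (f u - f v))" for f :: "'a \<Rightarrow> real"
proof (rule eq_vecI)
  fix i assume "i < dim_vec (vec_of (\<lambda>u. \<Sum>v\<in>verts G. of_bool (u \<rightarrow>\<^bsub>G\<^esub> v) * (f u - f v)))"
  then have i: "i < n" by (simp add: vec_of_def)
  let ?u = "vs ! i"
  have "(L *\<^sub>v vec_of f) $ i = (\<Sum>j<n. L $$ (i, j) * f (vs ! j))"
    using i L_carrier by (simp add: vec_of_def scalar_prod_def atLeast0LessThan)
  also have "\<dots> = (\<Sum>j<n. (if j = i then out_degree G ?u * f ?u else 0)
      - of_bool (?u \<rightarrow>\<^bsub>G\<^esub> vs ! j) * f (vs ! j))"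
    using i by (intro sum.cong)
      (auto simp: laplacian_mat_def degree_mat_def adjacency_mat_def left_diff_distrib)
  also have "\<dots> = out_degree G ?u * f ?u - (\<Sum>j<n. of_bool (?u \<rightarrow>\<^bsub>G\<^esub> vs ! j) * f (vs ! j))"
    using i by (simp add: sum_subtractf)
  also have "(\<Sum>j<n. of_bool (?u \<rightarrow>\<^bsub>G\<^esub> vs ! j) * f (vs ! j))
      = (\<Sum>v\<in>verts G. of_bool (?u \<rightarrow>\<^bsub>G\<^esub> v) * f v)"
    by (rule sum_nth[of "\<lambda>v. of_bool (?u \<rightarrow>\<^bsub>G\<^esub> v) * f v"])
  also have "out_degree G ?u * f ?u = (\<Sum>v\<in>verts G. of_bool (?u \<rightarrow>\<^bsub>G\<^esub> v) * f ?u)"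
    by (simp only: out_degree_sum sum_distrib_right)
  finally show "(L *\<^sub>v vec_of f) $ i = vec_of (\<lambda>u. \<Sum>v\<in>verts G. of_bool (u \<rightarrow>\<^bsub>G\<^esub> v) * (f u - f v)) $ i"
    using i by (simp add: vec_of_def right_diff_distrib sum_subtractf del: sum_of_bool_mult_eq)
qed (use L_carrier in \<open>simp add: vec_of_def\<close>)

text \<open>Averaging the double sum with its swapped version symmetrises it, since
  \<open>f u * (f u - f v) + f v * (f v - f u) = (f u - f v)\<^sup>2\<close>.\<close>

lemma L_form:
  "vec_of f \<bullet> (L *\<^sub>v vec_of f) = (\<Sum>u\<in>verts G. \<Sum>v\<in>verts G. of_bool (u \<rightarrow>\<^bsub>G\<^esub> v) * (f u - f v)\<^sup>2) / 2" for f :: "'a \<Rightarrow> real"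
proof -
  let ?V = "verts G"
  let ?a = "\<lambda>u v. of_bool (u \<rightarrow>\<^bsub>G\<^esub> v) :: real"
  have sym: "?a u v = ?a v u" for u v
    using arcs_ends_symmetric[OF sym_arcs] by auto
  let ?S = "\<Sum>u\<in>?V. \<Sum>v\<in>?V. ?a u v * (f u * (f u - f v))"
  have form: "vec_of f \<bullet> (L *\<^sub>v vec_of f) = ?S"
    unfolding L_vec_of vec_of_scalar_prod sum_distrib_left
    by (simp add: mult.left_commute del: sum_of_bool_mult_eq)
  have "?S = (\<Sum>u\<in>?V. \<Sum>v\<in>?V. ?a u v * (f v * (f v - f u)))"
    by (subst sum.swap) (subst sym, rule refl)
  then have "?S + ?S = (\<Sum>u\<in>?V. \<Sum>v\<in>?V. ?a u v * (f u * (f u - f v)) + ?a u v * (f v * (f v - f u)))"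
    by (simp add: sum.distrib del: sum_of_bool_mult_eq)
  also have "\<dots> = (\<Sum>u\<in>?V. \<Sum>v\<in>?V. ?a u v * (f u - f v)\<^sup>2)"
    by (intro sum.cong refl) (simp add: power2_eq_square algebra_simps)
  finally have "?S + ?S = (\<Sum>u\<in>?V. \<Sum>v\<in>?V. ?a u v * (f u - f v)\<^sup>2)" .
  with form show ?thesis by linarith
qed

lemma L_form_nonneg: "vec_of f \<bullet> (L *\<^sub>v vec_of f) \<ge> 0" for f :: "'a \<Rightarrow> real"
  unfolding L_form by (intro divide_nonneg_pos sum_nonneg) auto

text \<open>Two distinct vertices are adjacent in exactly one of \<open>G\<close> and its
  complement, so the two Laplacian forms add up to that of the complete graph.\<close>

lemma L_form_complement:
  "vec_of f \<bullet> (L *\<^sub>v vec_of f)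
    = n * (\<Sum>v\<in>verts G. (f v)\<^sup>2) - (\<Sum>v\<in>verts G. f v)\<^sup>2 - co_energy G f" for f :: "'a \<Rightarrow> real"
proof -
  let ?V = "verts G"
  have "2 * (vec_of f \<bullet> (L *\<^sub>v vec_of f)) + 2 * co_energy G f
      = (\<Sum>u\<in>?V. \<Sum>v\<in>?V. of_bool (u \<rightarrow>\<^bsub>G\<^esub> v) * (f u - f v)\<^sup>2 + of_bool (co_adj G u v) * (f u - f v)\<^sup>2)"
    unfolding L_form co_energy_def by (simp add: sum.distrib del: sum_of_bool_mult_eq)
  also have "\<dots> = (\<Sum>u\<in>?V. \<Sum>v\<in>?V. (f u - f v)\<^sup>2)"
    by (intro sum.cong refl) (auto simp: co_adj_def)
  finally show ?thesis
    by (simp add: sum_sum_sq_diff card_verts)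
qed

section \<open>Variational bounds for the second eigenvalue\<close>

lemma second_eigenpair:
  obtains f g \<mu> where
    "(\<Sum>v\<in>verts G. (f v)\<^sup>2) = 1" "(\<Sum>v\<in>verts G. (g v)\<^sup>2) = 1" "(\<Sum>v\<in>verts G. f v * g v) = 0"
    "L *\<^sub>v vec_of f = \<mu> \<cdot>\<^sub>v vec_of f" "L *\<^sub>v vec_of g = \<mu>\<^sub>2 \<cdot>\<^sub>v vec_of g" "\<mu> \<le> \<mu>\<^sub>2"
    "\<And>h. (\<Sum>v\<in>verts G. f v * h v) = 0 \<Longrightarrow>
      \<mu>\<^sub>2 * (\<Sum>v\<in>verts G. (h v)\<^sup>2) \<le> vec_of h \<bullet> (L *\<^sub>v vec_of h)"
proof -
  have "\<mu>\<^sub>2 = sorted_list_of_multiset (proots (char_poly L)) ! 1"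
    by (simp add: laplacian_eigenvalue_def laplacian_eigenvalues_def)
  note * = second_eigenvalue_of_symmetric[OF L_carrier L_sym two_verts, folded this]
  obtain u w \<mu> where uw: "u \<in> carrier_vec n" "w \<in> carrier_vec n"
    and norm: "u \<bullet> u = 1" "w \<bullet> w = 1" "u \<bullet> w = 0"
    and eig: "L *\<^sub>v u = \<mu> \<cdot>\<^sub>v u" "L *\<^sub>v w = \<mu>\<^sub>2 \<cdot>\<^sub>v w" "\<mu> \<le> \<mu>\<^sub>2"
    and ray: "\<And>x. x \<in> carrier_vec n \<Longrightarrow> u \<bullet> x = 0 \<Longrightarrow> \<mu>\<^sub>2 * (x \<bullet> x) \<le> x \<bullet> (L *\<^sub>v x)"
    using * by blast
  obtain f where f: "u = vec_of f" using vec_of_surj[OF uw(1)] .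
  obtain g where g: "w = vec_of g" using vec_of_surj[OF uw(2)] .
  show ?thesis
  proof (rule that[of f g \<mu>])
    show "\<mu>\<^sub>2 * (\<Sum>v\<in>verts G. (h v)\<^sup>2) \<le> vec_of h \<bullet> (L *\<^sub>v vec_of h)"
      if "(\<Sum>v\<in>verts G. f v * h v) = 0" for h
      using ray[of "vec_of h"] that by (simp add: f vec_of_scalar_prod power2_eq_square)
  qed (use norm eig in \<open>simp_all add: f g vec_of_scalar_prod power2_eq_square\<close>)
qed

lemma eigenvalue_2_nonneg: "\<mu>\<^sub>2 \<ge> 0"
proof -
  obtain g where "(\<Sum>v\<in>verts G. (g v)\<^sup>2) = 1" and g: "L *\<^sub>v vec_of g = \<mu>\<^sub>2 \<cdot>\<^sub>v vec_of g"
    by (rule second_eigenpair) blast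
  then show ?thesis
    using L_form_nonneg[of g] unfolding g
    by (simp add: vec_of_scalar_prod scalar_prod_smult_distrib[of _ n] power2_eq_square)
qed

text \<open>The plane spanned by the constants and \<open>h\<close> meets the hyperplane orthogonal to the first
  eigenvector.\<close>

lemma co_energy_le:
  assumes h0: "(\<Sum>v\<in>verts G. h v) = 0"
  shows "co_energy G h \<le> (n - \<mu>\<^sub>2) * (\<Sum>v\<in>verts G. (h v)\<^sup>2)"
proof -
  let ?V = "verts G"
  obtain f where ray: "\<And>h. (\<Sum>v\<in>?V. f v * h v) = 0 \<Longrightarrow>
      \<mu>\<^sub>2 * (\<Sum>v\<in>?V. (h v)\<^sup>2) \<le> vec_of h \<bullet> (L *\<^sub>v vec_of h)"
    by (rule second_eigenpair) blast
  define b where "b = (\<Sum>v\<in>?V. f v)"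
  \<comment> \<open>By \<open>aff1\<close>, the function \<open>a + b * h\<close> is orthogonal to
    the eigenfunction \<open>f\<close>.\<close>
  define a where "a = - (\<Sum>v\<in>?V. f v * h v)"
  define S where "S = (\<Sum>v\<in>?V. (h v)\<^sup>2)"
  have S: "S \<ge> 0" by (simp add: S_def sum_nonneg)
  have aff1: "(\<Sum>v\<in>?V. f v * (a' + b' * h v)) = a' * b - b' * a" for a' b'
    by (simp add: a_def b_def distrib_left sum.distrib sum_distrib_left sum_negf algebra_simps)
  have aff2: "(\<Sum>v\<in>?V. (a' + b' * h v)\<^sup>2) = n * a'\<^sup>2 + b'\<^sup>2 * S" for a' b' :: real
  proof -
    have "(\<Sum>v\<in>?V. (a' + b' * h v)\<^sup>2) = (\<Sum>v\<in>?V. a'\<^sup>2 + b'\<^sup>2 * (h v)\<^sup>2 + 2 * a' * b' * h v)"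
      by (simp add: power2_sum power_mult_distrib algebra_simps)
    also have "\<dots> = n * a'\<^sup>2 + b'\<^sup>2 * S + 2 * a' * b' * (\<Sum>v\<in>?V. h v)"
      by (simp add: sum.distrib S_def card_verts flip: sum_distrib_left)
    finally show ?thesis using h0 by simp
  qed
  have aff3: "(\<Sum>v\<in>?V. a' + b' * h v) = n * a'" for a' b' :: real
    using h0 by (simp add: sum.distrib card_verts flip: sum_distrib_left)
  have key: "\<mu>\<^sub>2 * (n * a'\<^sup>2 + b'\<^sup>2 * S) \<le> n * (b'\<^sup>2 * S) - b'\<^sup>2 * co_energy G h"
    if "a' * b = b' * a" for a' b' :: real
    using ray[of "\<lambda>v. a' + b' * h v"] that
    unfolding aff1 L_form_complement aff2 aff3 co_energy_affine
    by (simp add: power2_eq_square algebra_simps)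
  show ?thesis
  proof (cases "b = 0")
    \<comment> \<open>Here the constants themselves are orthogonal to \<open>f\<close>, which forces
      \<open>\<mu>\<^sub>2 = 0\<close>; the claim then says that the form of \<open>L\<close> is
      nonnegative at \<open>h\<close>.\<close>
    case True
    have "n * \<mu>\<^sub>2 \<le> 0" using key[of 1 0] True by (simp add: mult.commute)
    then have "\<mu>\<^sub>2 = 0"
      using eigenvalue_2_nonneg two_verts by (auto simp: mult_le_0_iff)
    then show ?thesis
      using L_form_nonneg[of h] h0 by (simp add: L_form_complement)
  next
    case False
    \<comment> \<open>The constant part of \<open>a + b * h\<close> enters \<open>key\<close> only
      through a nonnegative term on the left, which is dropped; \<open>b\<^sup>2\<close> then
      cancels.\<close>
    have "b\<^sup>2 * co_energy G h \<le> b\<^sup>2 * ((n - \<mu>\<^sub>2) * S)"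
    proof -
      have "\<mu>\<^sub>2 * (n * a\<^sup>2) \<ge> 0" using eigenvalue_2_nonneg by simp
      with key[of a b] show ?thesis by (simp add: algebra_simps)
    qed
    then show ?thesis using False by (simp add: S_def)
  qed
qed

text \<open>The plane spanned by the first two eigenvectors meets the hyperplane of sum zero.\<close>

lemma co_energy_ge_witness:
  obtains h where "(\<Sum>v\<in>verts G. h v) = 0" "(\<Sum>v\<in>verts G. (h v)\<^sup>2) > 0"
    "(n - \<mu>\<^sub>2) * (\<Sum>v\<in>verts G. (h v)\<^sup>2) \<le> co_energy G h"
proof -
  let ?V = "verts G"
  obtain f g \<mu> where norm: "(\<Sum>v\<in>?V. (f v)\<^sup>2) = 1" "(\<Sum>v\<in>?V. (g v)\<^sup>2) = 1" "(\<Sum>v\<in>?V. f v * g v) = 0"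
    and eig: "L *\<^sub>v vec_of f = \<mu> \<cdot>\<^sub>v vec_of f" "L *\<^sub>v vec_of g = \<mu>\<^sub>2 \<cdot>\<^sub>v vec_of g" "\<mu> \<le> \<mu>\<^sub>2"
    by (rule second_eigenpair) blast
  \<comment> \<open>A nontrivial solution of one linear equation in two unknowns, which gives the
    combination of \<open>f\<close> and \<open>g\<close> sum zero.\<close>
  obtain a b where ab: "a * (\<Sum>v\<in>?V. f v) + b * (\<Sum>v\<in>?V. g v) = 0" "a \<noteq> 0 \<or> b \<noteq> 0"
  proof (cases "(\<Sum>v\<in>?V. g v) = 0")
    case True then show ?thesis using that[of 0 1] by simp
  next
    case False then show ?thesis using that[of "(\<Sum>v\<in>?V. g v)" "- (\<Sum>v\<in>?V. f v)"] by simp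
  qed
  define h where "h v = a * f v + b * g v" for v
  have sum0: "(\<Sum>v\<in>?V. h v) = 0"
    using ab by (simp add: h_def sum.distrib sum_distrib_left)
  have "(\<Sum>v\<in>?V. (h v)\<^sup>2) = (\<Sum>v\<in>?V. a\<^sup>2 * (f v)\<^sup>2 + b\<^sup>2 * (g v)\<^sup>2 + 2 * a * b * (f v * g v))"
    by (simp add: h_def power2_sum power_mult_distrib algebra_simps)
  also have "\<dots> = a\<^sup>2 + b\<^sup>2"
    using norm by (simp add: sum.distrib flip: sum_distrib_left)
  finally have hh: "(\<Sum>v\<in>?V. (h v)\<^sup>2) = a\<^sup>2 + b\<^sup>2" .
  have h: "vec_of h = a \<cdot>\<^sub>v vec_of f + b \<cdot>\<^sub>v vec_of g"
    by (intro eq_vecI) (auto simp: vec_of_def h_def)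
  have "L *\<^sub>v vec_of h = vec_of (\<lambda>v. a * \<mu> * f v + b * \<mu>\<^sub>2 * g v)"
    unfolding h using L_carrier eig
    by (subst mult_add_distrib_mat_vec[of _ n n])
       (auto simp: mult_mat_vec[of _ n n] vec_of_def intro!: eq_vecI)
  then have "vec_of h \<bullet> (L *\<^sub>v vec_of h) = (\<Sum>v\<in>?V. h v * (a * \<mu> * f v + b * \<mu>\<^sub>2 * g v))"
    by (simp add: vec_of_scalar_prod)
  also have "\<dots> = (\<Sum>v\<in>?V. a\<^sup>2 * \<mu> * (f v)\<^sup>2 + b\<^sup>2 * \<mu>\<^sub>2 * (g v)\<^sup>2 + (a * b * (\<mu>\<^sub>2 + \<mu>)) * (f v * g v))"
    by (intro sum.cong) (auto simp: h_def power2_eq_square algebra_simps)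
  also have "\<dots> = a\<^sup>2 * \<mu> + b\<^sup>2 * \<mu>\<^sub>2"
    using norm by (simp add: sum.distrib flip: sum_distrib_left)
  \<comment> \<open>Both eigenvalues are at most \<open>\<mu>\<^sub>2\<close>, which bounds the form
    of \<open>L\<close> from above; sum zero turns this into a lower bound for
    \<open>co_energy\<close>.\<close>
  also have "\<dots> \<le> \<mu>\<^sub>2 * (a\<^sup>2 + b\<^sup>2)"
    using eig(3) mult_left_mono[OF eig(3), of "a\<^sup>2"] by (simp add: algebra_simps)
  finally have "(n - \<mu>\<^sub>2) * (\<Sum>v\<in>?V. (h v)\<^sup>2) \<le> co_energy G h"
    using sum0 by (simp add: L_form_complement hh algebra_simps)
  moreover have "(\<Sum>v\<in>?V. (h v)\<^sup>2) > 0"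
    unfolding hh using ab(2) by (simp add: sum_power2_gt_zero_iff)
  ultimately show ?thesis using sum0 that by blast
qed

text \<open>At a unit eigenvector the form of \<open>L\<close> equals \<open>\<mu>\<^sub>2\<close>,
  and it is \<open>n\<close> minus two nonnegative terms.\<close>

lemma eigenvalue_2_le_order: "\<mu>\<^sub>2 \<le> n"
proof -
  obtain g where g1: "(\<Sum>v\<in>verts G. (g v)\<^sup>2) = 1" and g: "L *\<^sub>v vec_of g = \<mu>\<^sub>2 \<cdot>\<^sub>v vec_of g"
    by (rule second_eigenpair) blast
  have "\<mu>\<^sub>2 = vec_of g \<bullet> (L *\<^sub>v vec_of g)"
    using g1 unfolding g
    by (simp add: vec_of_scalar_prod scalar_prod_smult_distrib[of _ n] power2_eq_square)
  also have "\<dots> \<le> n"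
    unfolding L_form_complement g1 using co_energy_nonneg[of G g] zero_le_power2[of "sum g (verts G)"] by linarith
  finally show ?thesis .
qed

text \<open>The star function at \<open>v\<close> is a test function for
  \<open>co_energy_le\<close>. A neighbour in the complement is required because otherwise this
  function is zero.\<close>

lemma eigenvalue_2_le_co_degree:
  assumes "v \<in> verts G" "co_nbrs G v \<noteq> {}"
  shows "\<mu>\<^sub>2 \<le> real n - real (card (co_nbrs G v) + 1)"
proof -
  define d where "d = card (co_nbrs G v)"
  have d: "d > 0" using assms(2) by (simp add: d_def card_gt_0_iff)
  define c where "c = real d * (real d + 1)"
  obtain f where f: "(\<Sum>u\<in>verts G. f u) = 0" "(\<Sum>u\<in>verts G. (f u)\<^sup>2) = c"
    "co_energy G f \<ge> real d * (real d + 1)\<^sup>2"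
    by (rule co_energy_star[OF assms(1), folded d_def, folded c_def])
  have "(real d + 1) * c \<le> (n - \<mu>\<^sub>2) * c"
    using co_energy_le[OF f(1)] f(2,3) by (simp add: c_def power2_eq_square mult_ac)
  then have "real d + 1 \<le> n - \<mu>\<^sub>2"
    using d by (simp add: c_def mult_le_cancel_right)
  then show ?thesis unfolding d_def by linarith
qed

text \<open>Gives the converse directions of the equality cases: \<open>d = 0\<close> for complete
  graphs and \<open>d = 1\<close> for complements of perfect matchings.\<close>

lemma eigenvalue_2_ge_co_degree:
  assumes "\<And>v. v \<in> verts G \<Longrightarrow> card (co_nbrs G v) \<le> d"
  shows "\<mu>\<^sub>2 \<ge> real n - 2 * real d"
proof -
  obtain h where pos: "(\<Sum>v\<in>verts G. (h v)\<^sup>2) > 0"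
    and le: "(n - \<mu>\<^sub>2) * (\<Sum>v\<in>verts G. (h v)\<^sup>2) \<le> co_energy G h"
    using co_energy_ge_witness by blast
  have "co_energy G h \<le> 2 * (\<Sum>u\<in>verts G. card (co_nbrs G u) * (h u)\<^sup>2)"
    by (rule co_energy_le_degree)
  also have "\<dots> \<le> 2 * (\<Sum>u\<in>verts G. d * (h u)\<^sup>2)"
    using assms by (intro mult_left_mono sum_mono mult_right_mono) auto
  finally have "(n - \<mu>\<^sub>2) * (\<Sum>v\<in>verts G. (h v)\<^sup>2) \<le> 2 * d * (\<Sum>v\<in>verts G. (h v)\<^sup>2)"
    using le by (simp add: sum_distrib_left mult.assoc)
  then show ?thesis using pos by (simp add: mult_le_cancel_right)
qed

end

section \<open>Domination and the complement\<close>

context graph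
begin

text \<open>Too small a set does not dominate, and a vertex it leaves undominated is adjacent in the
  complement to all of it.\<close>

lemma common_co_nbr:
  assumes "X \<subseteq> verts G" "card X < domination_number G"
  obtains w where "w \<in> verts G" "\<And>x. x \<in> X \<Longrightarrow> co_adj G w x"
proof -
  have "{X. dominating_set G X} \<subseteq> Pow (verts G)"
    by (auto simp: dominating_set_def)
  then have "finite {X. dominating_set G X}"
    by (rule finite_subset) simp
  then have "domination_number G \<le> card X" if "dominating_set G X"
    unfolding domination_number_def using that by (intro Min_le) auto
  with assms(2) have "\<not> dominating_set G X" by linarith
  then show ?thesis
    using assms(1) that by (auto simp: dominating_set_def co_adj_def)
qed

text \<open>Greedy growth: as long as a clique of the complement has fewer than \<gamma> vertices, a
  common neighbour extends it.\<close>

lemma co_clique: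
  assumes "k \<le> domination_number G"
  obtains K where "K \<subseteq> verts G" "card K = k" "\<And>u. u \<in> K \<Longrightarrow> K - {u} \<subseteq> co_nbrs G u"
  using assms
proof (induction k arbitrary: thesis)
  case 0
  then show ?case by (metis card.empty empty_iff empty_subsetI)
next
  case (Suc k)
  from Suc.prems(2) obtain K where K: "K \<subseteq> verts G" "card K = k"
    and clique: "\<And>u. u \<in> K \<Longrightarrow> K - {u} \<subseteq> co_nbrs G u"
    using Suc.IH by (metis Suc_leD)
  obtain w where w: "w \<in> verts G" "\<And>x. x \<in> K \<Longrightarrow> co_adj G w x"
    using common_co_nbr[OF K(1)] K(2) Suc.prems(2) by (metis Suc_le_lessD)
  have "w \<notin> K" using w(2)[of w] by (auto simp: co_adj_def)
  moreover have "finite K" using K(1) finite_verts finite_subset by blast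
  ultimately have "card (insert w K) = Suc k" using K(2) by simp
  moreover have "insert w K - {u} \<subseteq> co_nbrs G u" if "u \<in> insert w K" for u
    using that w K(1) clique[of u] co_adj_commute[of w u] by (auto simp: co_nbrs_def)
  ultimately show ?case
    using w(1) K(1) by (intro Suc.prems(1)[of "insert w K"]) auto
qed

text \<open>Under the degree bound, a clique of size \<open>\<gamma>\<close> in the complement is a whole component there, so
  \<open>\<gamma> - 2\<close> of its vertices together with a vertex outside it have no common neighbour.\<close>

lemma edgeless_of_co_degree:
  assumes \<gamma>: "domination_number G > 2"
    and deg: "\<And>v. v \<in> verts G \<Longrightarrow> card (co_nbrs G v) < domination_number G"
  shows "arcs G = {}"
proof -
  let ?\<gamma> = "domination_number G"
  obtain K where K: "K \<subseteq> verts G" "card K = ?\<gamma>"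
    and clique: "\<And>u. u \<in> K \<Longrightarrow> K - {u} \<subseteq> co_nbrs G u"
    using co_clique[of ?\<gamma>] by blast
  have finK: "finite K" using K(1) finite_verts finite_subset by blast
  have comp: "co_nbrs G u = K - {u}" if "u \<in> K" for u
  proof -
    \<comment> \<open>The degree bound allows at most \<gamma> - 1 neighbours, and the clique
      already supplies that many.\<close>
    have "card (co_nbrs G u) \<le> card (K - {u})"
      using deg[of u] that K finK by auto
    then show ?thesis
      using card_seteq[OF finite_co_nbrs clique[OF that]] by simp
  qed
  have "verts G \<subseteq> K"
  proof (rule ccontr)
    assume "\<not> verts G \<subseteq> K"
    then obtain v where v: "v \<in> verts G" "v \<notin> K" by blast
    obtain Y where Y: "Y \<subseteq> K" "card Y = ?\<gamma> - 2"
      using obtain_subset_with_card_n[of "?\<gamma> - 2" K] K(2) by auto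
    then obtain y where y: "y \<in> Y" using \<gamma> by (metis card.empty all_not_in_conv diff_is_0_eq leD)
    have "finite Y" "v \<notin> Y" using Y finK finite_subset v by auto
    then have "card (insert v Y) < ?\<gamma>" using Y(2) \<gamma> by simp
    then obtain w where w: "w \<in> verts G" "\<And>x. x \<in> insert v Y \<Longrightarrow> co_adj G w x"
      using common_co_nbr[of "insert v Y"] v(1) Y(1) K(1) by blast
    \<comment> \<open>Adjacency to \<open>y\<close> in the complement puts \<open>w\<close> into
      \<open>K\<close>, and adjacency to \<open>w\<close> then puts \<open>v\<close> into
      \<open>K\<close>. An element \<open>y\<close> exists because \<gamma> > 2.\<close>
    have "w \<in> co_nbrs G y" using w(1) w(2)[of y] y co_adj_commute[of w y] by (simp add: co_nbrs_def)
    then have "w \<in> K" using comp[of y] y Y(1) by blast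
    moreover have "v \<in> co_nbrs G w" using w(2)[of v] v(1) by (simp add: co_nbrs_def)
    ultimately show False using comp[of w] v(2) by blast
  qed
  then have "co_adj G u v" if "u \<in> verts G" "v \<in> verts G" "u \<noteq> v" for u v
    using comp[of u] that by (auto simp: co_nbrs_def)
  then have "\<not> u \<rightarrow>\<^bsub>G\<^esub> v" for u v
    by (metis adj_in_verts adj_not_same co_adj_def)
  then show ?thesis by (auto simp: arcs_ends_conv)
qed

text \<open>A graph is a perfect matching exactly when all its degrees are 1; for the converse,
  \<open>M\<close> is the edge set of the complement. In this form the condition meets the degree
  bounds directly.\<close>

lemma complement_of_perfect_matching_iff:
  "complement_of_perfect_matching G \<longleftrightarrow> (\<forall>v\<in>verts G. card (co_nbrs G v) = 1)"
proof
  assume "complement_of_perfect_matching G"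
  then obtain M where M: "perfect_matching_on (verts G) M"
    and adj: "\<And>u v. u \<in> verts G \<Longrightarrow> v \<in> verts G \<Longrightarrow> u \<noteq> v \<Longrightarrow> u \<rightarrow>\<^bsub>G\<^esub> v \<longleftrightarrow> {u, v} \<notin> M"
    unfolding complement_of_perfect_matching_def by blast
  show "\<forall>v\<in>verts G. card (co_nbrs G v) = 1"
  proof
    fix v assume v: "v \<in> verts G"
    then obtain e where e: "e \<in> M" "v \<in> e" and uniq: "\<And>e'. e' \<in> M \<Longrightarrow> v \<in> e' \<Longrightarrow> e' = e"
      using M unfolding perfect_matching_on_def by metis
    have "card e = 2" "e \<subseteq> verts G" using M e(1) unfolding perfect_matching_on_def by auto
    then obtain w where w: "e = {v, w}" "w \<noteq> v" "w \<in> verts G"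
      using e(2) by (auto simp: card_2_iff)
    have "co_nbrs G v = {w}"
    proof (intro equalityI subsetI)
      fix x assume "x \<in> co_nbrs G v"
      then have "{v, x} \<in> M" "x \<noteq> v" using adj[OF v, of x] by (auto simp: co_nbrs_def co_adj_def)
      then show "x \<in> {w}" using uniq[of "{v, x}"] w by (auto simp: doubleton_eq_iff)
    qed (use adj[OF v w(3)] w e(1) in \<open>auto simp: co_nbrs_def co_adj_def\<close>)
    then show "card (co_nbrs G v) = 1" by simp
  qed
next
  assume one: "\<forall>v\<in>verts G. card (co_nbrs G v) = 1"
  define M where "M = {{u, v} |u v. u \<in> verts G \<and> v \<in> co_nbrs G u}"
  have mem: "{u, v} \<in> M \<longleftrightarrow> co_adj G u v" if "u \<in> verts G" "v \<in> verts G" for u v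
    using that co_adj_commute[of u v] by (auto simp: M_def co_nbrs_def doubleton_eq_iff)
  have "perfect_matching_on (verts G) M"
    unfolding perfect_matching_on_def
  proof (intro conjI ballI)
    fix e assume "e \<in> M"
    then show "e \<subseteq> verts G" "card e = 2"
      by (auto simp: M_def co_nbrs_def co_adj_def card_2_iff)
  next
    fix v assume v: "v \<in> verts G"
    with one obtain w where w: "co_nbrs G v = {w}" by (meson card_1_singletonE)
    show "\<exists>!e. e \<in> M \<and> v \<in> e"
    proof
      show "{v, w} \<in> M \<and> v \<in> {v, w}" using v w by (auto simp: M_def)
      fix e assume e: "e \<in> M \<and> v \<in> e"
      then obtain x where "e = {v, x}" "x \<in> verts G" "co_adj G v x"
        using co_adj_commute by (auto simp: M_def co_nbrs_def insert_commute)
      then show "e = {v, w}" using w by (auto simp: co_nbrs_def)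
    qed
  qed
  moreover have "u \<rightarrow>\<^bsub>G\<^esub> v \<longleftrightarrow> {u, v} \<notin> M" if "u \<in> verts G" "v \<in> verts G" "u \<noteq> v" for u v
    using mem[OF that(1,2)] that(3) by (simp add: co_adj_def)
  ultimately show "complement_of_perfect_matching G"
    unfolding complement_of_perfect_matching_def by blast
qed

end

section \<open>The bounds on the second eigenvalue and their equality cases\<close>

context enumerated_graph
begin

text \<open>A single non-adjacent pair would push \<open>\<mu>\<^sub>2\<close> below
  \<open>n\<close> by the star bound; conversely all complement degrees are 0.\<close>

lemma eigenvalue_2_eq_order_iff: "\<mu>\<^sub>2 = n \<longleftrightarrow> complete_digraph n G"
proof
  assume "\<mu>\<^sub>2 = n"
  then have "co_nbrs G v = {}" if "v \<in> verts G" for v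
    using eigenvalue_2_le_co_degree[OF that] by linarith
  then have "u \<rightarrow>\<^bsub>G\<^esub> v" if "u \<in> verts G" "v \<in> verts G" "u \<noteq> v" for u v
    using that by (auto simp: co_nbrs_def co_adj_def)
  then have "arcs_ends G = {(u, v). (u, v) \<in> verts G \<times> verts G \<and> u \<noteq> v}"
    by (auto dest: adj_in_verts adj_not_same)
  then show "complete_digraph n G"
    using card_verts graph_axioms by (simp add: complete_digraph_def)
next
  assume "complete_digraph n G"
  then have "co_nbrs G v = {}" if "v \<in> verts G" for v
    using that by (auto simp: complete_digraph_def co_nbrs_def co_adj_def)
  then have "\<mu>\<^sub>2 \<ge> n" using eigenvalue_2_ge_co_degree[of 0] by simp
  then show "\<mu>\<^sub>2 = n" using eigenvalue_2_le_order by simp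
qed

text \<open>A vertex of a clique of size \<gamma> in the complement has at least \<gamma> - 1
  neighbours there, a positive number, so the star bound applies.\<close>

lemma eigenvalue_2_le_domination:
  assumes "domination_number G \<ge> 2"
  shows "\<mu>\<^sub>2 \<le> real n - real (domination_number G)"
proof -
  let ?\<gamma> = "domination_number G"
  obtain K where K: "K \<subseteq> verts G" "card K = ?\<gamma>"
    and clique: "\<And>u. u \<in> K \<Longrightarrow> K - {u} \<subseteq> co_nbrs G u"
    using co_clique[of ?\<gamma>] by blast
  obtain v where v: "v \<in> K" using K(2) assms by fastforce
  have "?\<gamma> - 1 \<le> card (co_nbrs G v)"
    using card_mono[OF finite_co_nbrs clique[OF v]] v K(2) by simp
  then have "co_nbrs G v \<noteq> {}" "real ?\<gamma> \<le> real (card (co_nbrs G v) + 1)"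
    using assms by auto
  with eigenvalue_2_le_co_degree[of v] v K(1) show ?thesis by fastforce
qed

lemma co_degree_less_domination:
  assumes "domination_number G \<ge> 2" "\<mu>\<^sub>2 = real n - real (domination_number G)" "v \<in> verts G"
  shows "card (co_nbrs G v) < domination_number G"
proof (cases "co_nbrs G v = {}")
  case True
  then show ?thesis using assms(1) by simp
next
  case False
  then show ?thesis using eigenvalue_2_le_co_degree[OF assms(3)] assms(2) by simp
qed

text \<open>In the complement every degree is at least 1, since one vertex does not dominate, and
  equality makes it less than 2. Conversely, degrees 1 give the matching lower bound.\<close>

lemma eigenvalue_2_eq_domination_2_iff:
  assumes "domination_number G = 2"
  shows "\<mu>\<^sub>2 = real n - 2 \<longleftrightarrow> complement_of_perfect_matching G"
  unfolding complement_of_perfect_matching_iff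
proof
  assume eq: "\<mu>\<^sub>2 = real n - 2"
  show "\<forall>v\<in>verts G. card (co_nbrs G v) = 1"
  proof
    fix v assume v: "v \<in> verts G"
    have X: "{v} \<subseteq> verts G" "card {v} < domination_number G" using v assms by simp_all
    obtain w where w: "w \<in> verts G" "co_adj G w v"
      using common_co_nbr[OF X] by (metis singletonI)
    then have "co_adj G v w" using co_adj_commute by blast
    then have "w \<in> co_nbrs G v" using w(1) by (simp add: co_nbrs_def)
    then have "card (co_nbrs G v) > 0" by (auto simp: card_gt_0_iff)
    then show "card (co_nbrs G v) = 1"
      using co_degree_less_domination[OF _ _ v] eq unfolding assms by simp
  qed
next
  assume "\<forall>v\<in>verts G. card (co_nbrs G v) = 1"
  then have "\<mu>\<^sub>2 \<ge> real n - 2" using eigenvalue_2_ge_co_degree[of 1] by simp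
  then show "\<mu>\<^sub>2 = real n - 2" using eigenvalue_2_le_domination assms by simp
qed

text \<open>Equality would keep every complement degree below \<gamma>, which forces
  \<open>G\<close> to be edgeless.\<close>

lemma eigenvalue_2_less_domination:
  assumes "domination_number G > 2" "arcs G \<noteq> {}"
  shows "\<mu>\<^sub>2 < real n - real (domination_number G)"
proof -
  have "domination_number G \<ge> 2" using assms(1) by simp
  then show ?thesis
    using eigenvalue_2_le_domination co_degree_less_domination edgeless_of_co_degree[OF assms(1)]
      assms(2) by (meson order_le_less)
qed

end

theorem theorem2:
  fixes G :: "('a, 'b) pre_digraph" and vs :: "'a list" and n \<gamma> :: nat
  assumes "graph G" and "card (verts G) = n" and "n \<ge> 2"
    and "distinct vs" and "set vs = verts G"
    and "domination_number G = \<gamma>"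
  shows "laplacian_eigenvalue G vs 2 \<le> (if \<gamma> = 1 then real n else real n - real \<gamma>)
    \<and> (\<gamma> = 1 \<longrightarrow> (laplacian_eigenvalue G vs 2 = real n \<longleftrightarrow> complete_digraph n G))
    \<and> (\<gamma> = 2 \<longrightarrow> (laplacian_eigenvalue G vs 2 = real n - real \<gamma>
          \<longleftrightarrow> complement_of_perfect_matching G))
    \<and> (\<gamma> > 2 \<and> arcs G \<noteq> {} \<longrightarrow> laplacian_eigenvalue G vs 2 < real n - real \<gamma>)"
proof -
  have n: "length vs = n"
    using assms distinct_card[of vs] by simp
  interpret graph G by fact
  interpret E: enumerated_graph G vs
    by unfold_locales (use assms n in auto)
  \<comment> \<open>For \<gamma> = 0 the asserted bound also reads \<open>n\<close>, so the bound by
    the order settles the first two cases.\<close>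
  consider "\<gamma> = 0" | "\<gamma> = 1" | "\<gamma> \<ge> 2" by linarith
  then have "laplacian_eigenvalue G vs 2 \<le> (if \<gamma> = 1 then real n else real n - real \<gamma>)"
    by cases (use E.eigenvalue_2_le_order E.eigenvalue_2_le_domination assms(6) n in auto)
  then show ?thesis
    using E.eigenvalue_2_eq_order_iff E.eigenvalue_2_eq_domination_2_iff
      E.eigenvalue_2_less_domination assms(6) n by auto
qed

end
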